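(* Let $n\ge 1$, $0<s<1$ and $p\ge 2$. Assume that $u\in C^{1,1}_{loc}(\mathbb{R}^n)\cap \mathcal{L}_{sp}(\mathbb{R}^n)$ is bounded and that $$(-\Delta)^s_p u(x)=0 \quad\text{for all } x\in\mathbb{R}^n.$$ Then $u$ is constant on $\mathbb{R}^n$, i.e. there is $C\in\mathbb{R}$ with $u\equiv C$.
   Context: For $u:\mathbb{R}^n\to\mathbb{R}$, the fractional $p$-Laplacian is defined pointwise by $$(-\Delta)_p^s u(x)=C_{n,sp}\lim_{\varepsilon\to 0^+}\int_{\mathbb{R}^n\setminus B_\varepsilon(x)}\frac{|u(x)-u(y)|^{p-2}(u(x)-u(y))}{|x-y|^{n+sp}}\,dy ,$$ where $C_{n,sp}>0$ is a constant depending only on $n,s,p$. The space $\mathcal{L}_{sp}(\mathbb{R}^n)$ is $$\mathcal{L}_{sp}=\Big\{u\in L^{p-1}_{loc}(\mathbb{R}^n)\ \Big|\ \int_{\mathbb{R}^n}\frac{|1+u(x)|^{p-1}}{1+|x|^{n+sp}}\,dx<\infty\Big\}.$$ $C^{1,1}_{loc}(\mathbb{R}^n)$ denotes the functions that are differentiable with locally Lipschitz gradient. The equation is understood in the classical pointwise sense. *)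

theory Defs
  imports "HOL-Analysis.Analysis"
begin

definition C11_loc :: "('a::euclidean_space \<Rightarrow> real) \<Rightarrow> bool" where
  "C11_loc u \<longleftrightarrow>
     (\<exists>g. (\<forall>x. GDERIV u x :> g x) \<and>
          (\<forall>x. \<exists>r>0. \<exists>L. L-lipschitz_on (ball x r) g))"

definition Lp_loc :: "real \<Rightarrow> ('a::euclidean_space \<Rightarrow> real) set" where
  "Lp_loc q = {u. u \<in> borel_measurable lebesgue \<and>
     (\<forall>K. compact K \<longrightarrow> set_integrable lebesgue K (\<lambda>x. \<bar>u x\<bar> powr q))}"

definition L_sp :: "real \<Rightarrow> real \<Rightarrow> ('a::euclidean_space \<Rightarrow> real) set" where
  "L_sp s p = {u \<in> Lp_loc (p - 1).
     integrable lebesgue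
       (\<lambda>x. \<bar>1 + u x\<bar> powr (p - 1) / (1 + norm x powr (real DIM('a) + s * p)))}"

text \<open>Here \<open>0 powr 0 = 0\<close>, but for \<open>p = 2\<close> that factor is multiplied by \<open>u x - u y = 0\<close>.\<close>

definition frac_p_integrand ::
  "real \<Rightarrow> real \<Rightarrow> ('a::euclidean_space \<Rightarrow> real) \<Rightarrow> 'a \<Rightarrow> 'a \<Rightarrow> real" where
  "frac_p_integrand s p u x y =
     \<bar>u x - u y\<bar> powr (p - 2) * (u x - u y) / norm (x - y) powr (real DIM('a) + s * p)"

text \<open>\<open>has_frac_p_laplacian c s p u x l\<close> says that the fractional \<open>p\<close>-Laplacian of \<open>u\<close> at \<open>x\<close>,
  with normalising constant \<open>c\<close>, exists and equals \<open>l\<close>.  It is a relation, so that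
  neither a divergent integral nor a nonexistent limit gets a default value.\<close>

definition has_frac_p_laplacian ::
  "real \<Rightarrow> real \<Rightarrow> real \<Rightarrow> ('a::euclidean_space \<Rightarrow> real) \<Rightarrow> 'a \<Rightarrow> real \<Rightarrow> bool" where
  "has_frac_p_laplacian c s p u x l \<longleftrightarrow>
     (\<forall>\<epsilon>>0. set_integrable lebesgue (UNIV - ball x \<epsilon>) (frac_p_integrand s p u x)) \<and>
     (\<exists>I. ((\<lambda>\<epsilon>. LINT y:UNIV - ball x \<epsilon>|lebesgue. frac_p_integrand s p u x y)
              \<longlongrightarrow> I) (at_right 0) \<and> l = c * I)"

end

theory Submission
  imports Defs
begin

text \<open>
  Let \<open>M\<close> and \<open>m\<close> be the supremum and the infimum of \<open>u\<close>, and let \<open>h = (M - m) / 2\<close>.  If \<open>u \<le> M - h\<close>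
  on at least half of the ball of radius \<open>R\<close>, then \<open>u \<le> M - \<theta> h\<close> on the ball of radius \<open>R / 2\<close>,
  with \<open>\<theta>\<close> independent of \<open>R\<close>.  Indeed, otherwise \<open>u + \<delta> (1 - |y|^2 / R^2)\<close>, with \<open>\<delta>\<close> a small multiple
  of \<open>h\<close>, attains its global maximum at some \<open>x\<close>, and by monotonicity of \<open>t \<mapsto> |t|^(p-2) t\<close> the
  integrand at \<open>x\<close> is bounded below by that of a quadratic polynomial.  The linear part of the polynomial
  is odd about \<open>x\<close> and drops out of the principal value; since \<open>p \<ge> 2\<close>, the rest contributes at least
  \<open>- C \<delta>^(p-1) R^(-sp)\<close>, while the set where \<open>u \<le> M - h\<close> contributes an additional
  \<open>c h^(p-1) R^(-sp)\<close>, so the operator cannot vanish at \<open>x\<close>.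
  For \<open>h > 0\<close> and \<open>R\<close> large this applies to \<open>u\<close> or to \<open>-u\<close>, and contradicts the choice of \<open>M\<close> or of \<open>m\<close>.
\<close>

subsection \<open>Integrals of the kernel\<close>

text \<open>The reflection \<open>2 x - y\<close> about \<open>x\<close> preserves Lebesgue measure
  and turns \<open>f\<close> into \<open>- f\<close>, so the integral equals its own negative. For a
  non-integrable \<open>f\<close> it is 0 by convention.\<close>

lemma lebesgue_integral_odd_about:
  fixes f :: "'a::euclidean_space \<Rightarrow> real"
  assumes f: "f \<in> borel_measurable lebesgue" and odd: "\<And>z. f (x - z) = - f (x + z)"
  shows "integral\<^sup>L lebesgue f = 0"
proof -
  \<comment> \<open>The coordinatewise form fits the affine change of variables; its Jacobian factor
    is a product of factors \<open>\<bar>-1\<bar>\<close>, hence 1.\<close>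
  define T where "T = (\<lambda>y. 2 *\<^sub>R x + (\<Sum>j\<in>Basis. ((-1) * (y \<bullet> j)) *\<^sub>R j))"
  have T: "T y = 2 *\<^sub>R x - y" for y
    by (simp add: T_def sum_negf euclidean_representation)
  have meas: "T \<in> lebesgue \<rightarrow>\<^sub>M lebesgue"
    unfolding T_def by (rule lebesgue_affine_measurable) auto
  have "(lebesgue :: 'a measure) = density (distr lebesgue lebesgue T) (\<lambda>_. ennreal (\<Prod>j\<in>(Basis::'a set). \<bar>-1 :: real\<bar>))"
    unfolding T_def by (rule lebesgue_affine_euclidean) auto
  then have "(lebesgue :: 'a measure) = distr lebesgue lebesgue T"
    by (simp add: density_1)
  then have "integral\<^sup>L lebesgue f = integral\<^sup>L (distr lebesgue lebesgue T) f"
    by simp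
  also have "\<dots> = (LINT y|lebesgue. f (T y))"
    using meas f by (rule integral_distr)
  also have "\<dots> = (LINT y|lebesgue. - f y)"
  proof (rule Bochner_Integration.integral_cong)
    fix y
    show "f (T y) = - f y"
      using odd[of "y - x"] by (simp add: T algebra_simps scaleR_2)
  qed simp
  finally show ?thesis by simp
qed

section \<open>Dyadic estimates for integrals of powers of the distance\<close>

lemma ex_dyadic_interval:
  fixes w :: real
  assumes "1 \<le> w"
  shows "\<exists>k. 2 ^ k \<le> w \<and> w < 2 ^ Suc k"
proof -
  obtain m where "w < 2 ^ m" using real_arch_pow[of 2 w] by auto
  moreover define k where "k = (LEAST m. w < 2 ^ m)"
  ultimately have k: "w < 2 ^ k" by (auto intro: LeastI)
  then have "k \<noteq> 0" using assms by (intro notI) simp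
  then obtain j where j: "k = Suc j" by (cases k) auto
  have "\<not> w < 2 ^ j" unfolding k_def
    using not_less_Least[of j "\<lambda>m. w < 2 ^ m"] j k_def by auto
  with k j show ?thesis by (intro exI[of _ j]) auto
qed

text \<open>The constant serves both signs of \<open>e\<close>: the power is largest at
  \<open>t = r\<close> for \<open>e \<ge> 0\<close>, and at \<open>t = r / 2\<close> for
  \<open>e < 0\<close>, where equality holds.\<close>

lemma powr_le_doubling:
  fixes e t r :: real
  assumes "0 < r" "r / 2 \<le> t" "t \<le> r"
  shows "t powr e \<le> 2 powr \<bar>e\<bar> * r powr e"
proof (cases "0 \<le> e")
  case True
  have "t powr e \<le> r powr e" using assms True by (intro powr_mono2) auto
  also have "\<dots> \<le> 2 powr \<bar>e\<bar> * r powr e"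
    using ge_one_powr_ge_zero[of 2 "\<bar>e\<bar>"] by (simp add: mult_le_cancel_right1)
  finally show ?thesis .
next
  case False
  have "t powr e \<le> (r / 2) powr e" using assms False by (intro powr_mono2') auto
  also have "\<dots> = 2 powr \<bar>e\<bar> * r powr e"
    using assms False by (simp add: powr_divide powr_minus field_simps)
  finally show ?thesis .
qed

text \<open>\<open>S\<close> is covered by shells of outer radius \<open>r k\<close>. There the
  power is at most a constant times \<open>r k powr e\<close>, and the enclosing ball has volume
  proportional to \<open>r k ^ DIM('a)\<close>, so each shell costs a constant times
  \<open>r k powr q\<close>. Replacing shells by balls and ignoring overlaps only weakens the upper
  bound.\<close>

lemma
  fixes x :: "'a::euclidean_space" and S :: "'a set"
  assumes S: "S \<in> sets lebesgue"
    and r: "\<And>k. 0 < r k" and cover: "\<And>y. y \<in> S \<Longrightarrow> \<exists>k. r k / 2 \<le> norm (x - y) \<and> norm (x - y) \<le> r k"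
    and sums: "(\<lambda>k. r k powr q) sums \<sigma>"
  defines "e \<equiv> q - real DIM('a)"
  shows dyadic_integrable: "integrable lebesgue (\<lambda>y. norm (x - y) powr e * indicator S y)" (is ?I)
    and dyadic_integral_le: "(LINT y|lebesgue. norm (x - y) powr e * indicator S y)
      \<le> 2 powr \<bar>e\<bar> * unit_ball_vol (real DIM('a)) * \<sigma>" (is ?L)
proof -
  let ?f = "\<lambda>y. norm (x - y) powr e * indicator S y"
  let ?C = "2 powr \<bar>e\<bar> * unit_ball_vol (real DIM('a)) * \<sigma>"
  define a where "a k = 2 powr \<bar>e\<bar> * r k powr e" for k
  have a0: "0 \<le> a k" for k by (simp add: a_def)
  have "(\<lambda>y. norm (x - y) powr e) \<in> borel_measurable lebesgue"
    by (intro measurable_completion) measurable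
  then have meas: "?f \<in> borel_measurable lebesgue"
    using S by (intro borel_measurable_times borel_measurable_indicator)
  have pw: "ennreal (?f y) \<le> (\<Sum>k. ennreal (a k) * indicator (cball x (r k)) y)" for y
  proof (cases "y \<in> S")
    case True
    then obtain k where k: "r k / 2 \<le> norm (x - y)" "norm (x - y) \<le> r k" using cover by blast
    have "?f y \<le> a k"
      using powr_le_doubling[OF r k] True by (simp add: a_def)
    then have "ennreal (?f y) \<le> ennreal (a k) * indicator (cball x (r k)) y"
      using k by (simp add: dist_norm ennreal_leI)
    also have "\<dots> \<le> (\<Sum>k. ennreal (a k) * indicator (cball x (r k)) y)"
      using sum_le_suminf[of "\<lambda>k. ennreal (a k) * indicator (cball x (r k)) y" "{k}"]
      by (simp add: summableI del: sum_mult_indicator)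
    finally show ?thesis .
  qed simp
  have "(\<integral>\<^sup>+y. ?f y \<partial>lebesgue) \<le> (\<integral>\<^sup>+y. (\<Sum>k. ennreal (a k) * indicator (cball x (r k)) y) \<partial>lebesgue)"
    by (intro nn_integral_mono pw)
  also have "\<dots> = (\<Sum>k. \<integral>\<^sup>+y. ennreal (a k) * indicator (cball x (r k)) y \<partial>lebesgue)"
    by (intro nn_integral_suminf borel_measurable_times_ennreal borel_measurable_const borel_measurable_indicator) auto
  also have "\<dots> = (\<Sum>k. ennreal (2 powr \<bar>e\<bar> * unit_ball_vol (real DIM('a)) * r k powr q))"
  proof (intro suminf_cong)
    fix k
    have "(\<integral>\<^sup>+y. ennreal (a k) * indicator (cball x (r k)) y \<partial>lebesgue) = ennreal (a k) * emeasure lebesgue (cball x (r k))"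
      by (intro nn_integral_cmult_indicator) auto
    also have "\<dots> = ennreal (a k * (unit_ball_vol (real DIM('a)) * r k ^ DIM('a)))"
      using r[of k] by (simp add: emeasure_cball ennreal_mult a0 less_imp_le)
    also have "a k * (unit_ball_vol (real DIM('a)) * r k ^ DIM('a)) = 2 powr \<bar>e\<bar> * unit_ball_vol (real DIM('a)) * r k powr q"
      using r[of k] by (simp add: a_def e_def powr_diff powr_realpow)
    finally show "(\<integral>\<^sup>+y. ennreal (a k) * indicator (cball x (r k)) y \<partial>lebesgue) = \<dots>" .
  qed
  also have "\<dots> = ennreal ?C"
    by (intro suminf_ennreal_eq sums_mult sums) auto
  finally have le: "(\<integral>\<^sup>+y. ?f y \<partial>lebesgue) \<le> ennreal ?C" .
  show ?I
    using meas le by (intro integrableI_nonneg) (auto simp: top_unique less_top[symmetric])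
  have "0 \<le> \<sigma>" using sums_le[OF _ sums_zero sums] by simp
  then show ?L
    using le by (intro integral_real_bounded) auto
qed

text \<open>Shells of outer radius \<open>R / 2 ^ k\<close> shrink to \<open>x\<close>; since
  \<open>q > 0\<close>, their costs form a convergent geometric series of ratio
  \<open>2 powr (-q)\<close>. The centre lies in no shell, so it is removed from the ball.\<close>

lemma
  fixes x :: "'a::euclidean_space"
  assumes "0 < q" "0 < R"
  defines "e \<equiv> q - real DIM('a)"
  shows integrable_norm_powr_ball: "integrable lebesgue (\<lambda>y. norm (x - y) powr e * indicator (ball x R - {x}) y)"
    and integral_norm_powr_ball_le: "(LINT y|lebesgue. norm (x - y) powr e * indicator (ball x R - {x}) y)
      \<le> 2 powr \<bar>e\<bar> * unit_ball_vol (real DIM('a)) * (R powr q / (1 - 2 powr (-q)))"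
proof -
  define r where "r k = R / 2 ^ k" for k :: nat
  have meas: "ball x R - {x} \<in> sets lebesgue" by simp
  have r: "0 < r k" for k using assms by (simp add: r_def)
  have cover: "\<exists>k. r k / 2 \<le> norm (x - y) \<and> norm (x - y) \<le> r k" if "y \<in> ball x R - {x}" for y
  proof -
    have t: "0 < norm (x - y)" "norm (x - y) < R" using that by (auto simp: dist_norm)
    then have "1 \<le> R / norm (x - y)" by simp
    from ex_dyadic_interval[OF this] obtain k where "2 ^ k \<le> R / norm (x - y)" "R / norm (x - y) < 2 ^ Suc k"
      by blast
    then show ?thesis using t by (intro exI[of _ k]) (simp add: r_def field_simps)
  qed
  have eq: "r k powr q = R powr q * (2 powr (-q)) ^ k" for k
    using assms by (simp add: r_def powr_divide powr_minus powr_powr powr_realpow[symmetric] field_simps)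
  have "(\<lambda>k. r k powr q) sums (R powr q * (1 / (1 - 2 powr (-q))))"
    unfolding eq using assms by (intro sums_mult geometric_sums) (simp add: powr_less_one)
  then have sums: "(\<lambda>k. r k powr q) sums (R powr q / (1 - 2 powr (-q)))" by simp
  show "integrable lebesgue (\<lambda>y. norm (x - y) powr e * indicator (ball x R - {x}) y)"
    "(LINT y|lebesgue. norm (x - y) powr e * indicator (ball x R - {x}) y)
      \<le> 2 powr \<bar>e\<bar> * unit_ball_vol (real DIM('a)) * (R powr q / (1 - 2 powr (-q)))"
    unfolding e_def using dyadic_integrable[OF meas r cover sums] dyadic_integral_le[OF meas r cover sums] by simp_all
qed

text \<open>Here the shells grow to infinity and the ratio \<open>2 powr (-a)\<close> is below 1.
  The first shell begins at radius \<open>R\<close> and so has outer radius \<open>2 * R\<close>,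
  which produces the extra factor \<open>2 powr (-a)\<close>.\<close>

lemma
  fixes x :: "'a::euclidean_space"
  assumes "0 < a" "0 < R"
  defines "e \<equiv> - a - real DIM('a)"
  shows integrable_norm_powr_outside: "integrable lebesgue (\<lambda>y. norm (x - y) powr e * indicator (- ball x R) y)"
    and integral_norm_powr_outside_le: "(LINT y|lebesgue. norm (x - y) powr e * indicator (- ball x R) y)
      \<le> 2 powr \<bar>e\<bar> * unit_ball_vol (real DIM('a)) * (R powr (-a) * 2 powr (-a) / (1 - 2 powr (-a)))"
proof -
  define r where "r k = 2 * R * 2 ^ k" for k :: nat
  have meas: "- ball x R \<in> sets lebesgue" by simp
  have r: "0 < r k" for k using assms by (simp add: r_def)
  have cover: "\<exists>k. r k / 2 \<le> norm (x - y) \<and> norm (x - y) \<le> r k" if "y \<in> - ball x R" for y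
  proof -
    have "1 \<le> norm (x - y) / R" using that assms by (auto simp: dist_norm)
    from ex_dyadic_interval[OF this] obtain k where "2 ^ k \<le> norm (x - y) / R" "norm (x - y) / R < 2 ^ Suc k"
      by blast
    then show ?thesis using assms by (intro exI[of _ k]) (simp add: r_def field_simps)
  qed
  have eq: "r k powr (-a) = R powr (-a) * 2 powr (-a) * (2 powr (-a)) ^ k" for k
  proof -
    have "(2 ^ k) powr (-a) = (2 powr (-a)) ^ k"
      by (simp add: powr_powr powr_realpow[symmetric] mult.commute)
    then show ?thesis using assms by (simp add: r_def powr_mult)
  qed
  have "(\<lambda>k. r k powr (-a)) sums (R powr (-a) * 2 powr (-a) * (1 / (1 - 2 powr (-a))))"
    unfolding eq using assms by (intro sums_mult geometric_sums) (simp add: powr_less_one)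
  then have sums: "(\<lambda>k. r k powr (-a)) sums (R powr (-a) * 2 powr (-a) / (1 - 2 powr (-a)))" by simp
  show "integrable lebesgue (\<lambda>y. norm (x - y) powr e * indicator (- ball x R) y)"
    "(LINT y|lebesgue. norm (x - y) powr e * indicator (- ball x R) y)
      \<le> 2 powr \<bar>e\<bar> * unit_ball_vol (real DIM('a)) * (R powr (-a) * 2 powr (-a) / (1 - 2 powr (-a)))"
    unfolding e_def using dyadic_integrable[OF meas r cover sums] dyadic_integral_le[OF meas r cover sums] by simp_all
qed

subsection \<open>The nonlinearity\<close>

text \<open>The numerator of \<open>frac_p_integrand\<close> as a function of
  \<open>u x - u y\<close>; for \<open>p \<ge> 2\<close> it is the odd extension of
  \<open>t powr (p - 1)\<close> to the line.\<close>

definition signed_powr :: "real \<Rightarrow> real \<Rightarrow> real" where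
  "signed_powr p t = \<bar>t\<bar> powr (p - 2) * t"

lemma signed_powr_minus [simp]: "signed_powr p (- t) = - signed_powr p t"
  by (simp add: signed_powr_def)

lemma borel_measurable_signed_powr [measurable]: "signed_powr p \<in> borel_measurable borel"
  unfolding signed_powr_def by measurable

lemma signed_powr_nonneg_eq: "2 \<le> p \<Longrightarrow> 0 \<le> t \<Longrightarrow> signed_powr p t = t powr (p - 1)"
  by (cases "t = 0") (auto simp: signed_powr_def powr_mult_base mult.commute)

lemma signed_powr_mono:
  assumes p: "2 \<le> p" and st: "s \<le> t"
  shows "signed_powr p s \<le> signed_powr p t"
proof -
  have mono: "signed_powr p a \<le> signed_powr p b" if "0 \<le> a" "a \<le> b" for a b
    using that p by (simp add: signed_powr_nonneg_eq powr_mono2)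
  consider "0 \<le> s" | "t \<le> 0" | "s < 0" "0 < t" by linarith
  then show ?thesis
  proof cases
    case 1
    then show ?thesis using mono st by blast
  next
    case 2
    then have "signed_powr p (- t) \<le> signed_powr p (- s)"
      using mono[of "- t" "- s"] st by (simp del: signed_powr_minus)
    then show ?thesis by simp
  next
    case 3
    have "signed_powr p s \<le> 0" using 3 by (simp add: signed_powr_def mult_le_0_iff)
    also have "0 \<le> signed_powr p t" using 3 by (simp add: signed_powr_def)
    finally show ?thesis .
  qed
qed

text \<open>Mean value theorem: the derivative is at most its value at \<open>a\<close> because
  \<open>q \<ge> 1\<close>. The case \<open>b = 0\<close> is separate, as the power is
  differentiated only at positive arguments.\<close>

lemma powr_diff_le:
  fixes a b q :: real
  assumes "1 \<le> q" "0 \<le> b" "b \<le> a"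
  shows "a powr q - b powr q \<le> q * a powr (q - 1) * (a - b)"
proof (cases "b = 0 \<or> a = b")
  case True
  have "a powr q = a powr (q - 1) * a" if "0 < a"
    using that powr_mult_base[of a "q - 1"] by (simp add: mult.commute)
  moreover have "1 * (a powr (q - 1) * a) \<le> q * (a powr (q - 1) * a)"
    using assms by (intro mult_right_mono) auto
  ultimately show ?thesis using True assms by (cases "a = 0") (auto simp: mult_ac)
next
  case False
  then have ab: "0 < b" "b < a" using assms by auto
  have "\<exists>z>b. z < a \<and> a powr q - b powr q = (a - b) * (q * z powr (q - 1))"
    using ab by (intro MVT2) (auto intro!: derivative_eq_intros)
  then obtain z where z: "b < z" "z < a" "a powr q - b powr q = (a - b) * (q * z powr (q - 1))" by blast
  have "z powr (q - 1) \<le> a powr (q - 1)" using z ab assms by (intro powr_mono2) auto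
  then have "(a - b) * (q * z powr (q - 1)) \<le> (a - b) * (q * a powr (q - 1))"
    using ab assms by (intro mult_left_mono) auto
  then show ?thesis using z by (simp add: mult_ac)
qed

text \<open>If \<open>a\<close> and \<open>a - b\<close> do not have opposite signs, this is
  \<open>powr_diff_le\<close>, after a reflection for negative arguments. Otherwise the difference
  is a sum of two powers, each bounded by monotonicity since \<open>p - 2 \<ge> 0\<close>, and
  \<open>p - 1 \<ge> 1\<close> leaves room for the factor.\<close>

lemma signed_powr_diff_le:
  assumes p: "2 \<le> p" and b: "0 \<le> b"
  shows "signed_powr p a - signed_powr p (a - b) \<le> (p - 1) * (\<bar>a\<bar> + b) powr (p - 2) * b"
proof -
  consider "b \<le> a" | "a \<le> 0" | "0 < a" "a < b" by linarith
  then show ?thesis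
  proof cases
    case 1
    have "signed_powr p a - signed_powr p (a - b) \<le> (p - 1) * a powr (p - 2) * b"
      using powr_diff_le[of "p - 1" "a - b" a] p b 1 by (simp add: signed_powr_nonneg_eq)
    also have "\<dots> \<le> (p - 1) * (\<bar>a\<bar> + b) powr (p - 2) * b"
      using p b 1 by (intro mult_right_mono mult_left_mono powr_mono2) auto
    finally show ?thesis .
  next
    case 2
    have "signed_powr p (b - a) - signed_powr p (- a) \<le> (p - 1) * (b - a) powr (p - 2) * b"
      using powr_diff_le[of "p - 1" "- a" "b - a"] p b 2
      by (simp add: signed_powr_nonneg_eq del: signed_powr_minus)
    moreover have "signed_powr p (a - b) = - signed_powr p (b - a)"
      using signed_powr_minus[of p "b - a"] by simp
    ultimately show ?thesis using 2 by (simp add: add.commute[of b])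
  next
    case 3
    have "signed_powr p (a - b) = - signed_powr p (b - a)"
      using signed_powr_minus[of p "b - a"] by simp
    then have "signed_powr p a - signed_powr p (a - b) = a powr (p - 2) * a + (b - a) powr (p - 2) * (b - a)"
      using 3 by (simp add: signed_powr_def)
    also have "\<dots> \<le> (\<bar>a\<bar> + b) powr (p - 2) * a + (\<bar>a\<bar> + b) powr (p - 2) * (b - a)"
      using 3 p by (intro add_mono mult_right_mono powr_mono2) auto
    also have "\<dots> = 1 * ((\<bar>a\<bar> + b) powr (p - 2) * b)" by (simp add: algebra_simps)
    also have "\<dots> \<le> (p - 1) * ((\<bar>a\<bar> + b) powr (p - 2) * b)"
      using p b by (intro mult_right_mono) auto
    finally show ?thesis by (simp add: mult_ac)
  qed
qed

subsection \<open>Touching by a paraboloid\<close>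

text \<open>The bump \<open>\<beta>\<close> is at least \<open>\<delta> / 2\<close> at
  \<open>x0\<close>, so the maximum of \<open>u + \<beta>\<close> over the closed ball exceeds
  \<open>M\<close>. Where \<open>R \<le> norm y\<close> the bump is at most 0 and the sum stays
  below \<open>M\<close>; hence the maximum is interior and global.\<close>

lemma touching_point_exists:
  fixes u :: "'a::euclidean_space \<Rightarrow> real"
  assumes cont: "continuous_on UNIV u" and le: "\<And>y. u y \<le> M" and R: "0 < R" and d: "0 < \<delta>"
    and x0: "x0 \<in> ball 0 (R / 2)" "M - \<delta> / 2 < u x0"
  obtains x where "x \<in> ball 0 R" "M - \<delta> < u x"
    "\<And>y. \<delta> * ((norm x)\<^sup>2 - (norm y)\<^sup>2) / R\<^sup>2 \<le> u x - u y"
proof -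
  define \<beta> where "\<beta> y = \<delta> * (1 - (norm y)\<^sup>2 / R\<^sup>2)" for y :: 'a
  have "continuous_on (cball 0 R) (\<lambda>y. u y + \<beta> y)"
    unfolding \<beta>_def using R by (intro continuous_intros continuous_on_subset[OF cont]) auto
  moreover have "compact (cball (0::'a) R)" "cball (0::'a) R \<noteq> {}" using R by auto
  ultimately have "\<exists>x\<in>cball 0 R. \<forall>y\<in>cball 0 R. u y + \<beta> y \<le> u x + \<beta> x"
    by (intro continuous_attains_sup)
  then obtain x where x: "x \<in> cball 0 R" "\<And>y. y \<in> cball 0 R \<Longrightarrow> u y + \<beta> y \<le> u x + \<beta> x"
    by blast
  have "(norm x0)\<^sup>2 \<le> (R / 2)\<^sup>2" using x0 by (intro power_mono) auto
  then have "4 * (norm x0)\<^sup>2 \<le> R\<^sup>2" by (simp add: power_divide)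
  then have "2 * (norm x0)\<^sup>2 \<le> R\<^sup>2" using zero_le_power2[of "norm x0"] by linarith
  then have "(norm x0)\<^sup>2 / R\<^sup>2 \<le> 1 / 2" using R by (simp add: field_simps)
  then have "\<delta> * (1 / 2) \<le> \<beta> x0" unfolding \<beta>_def using d by (intro mult_left_mono) auto
  with x0 have "M < u x0 + \<beta> x0" by simp
  also have "\<dots> \<le> u x + \<beta> x" using x0 R by (intro x) auto
  finally have big: "M < u x + \<beta> x" .
  have neg: "\<beta> y \<le> 0" if "R \<le> norm y" for y
  proof -
    have "R\<^sup>2 \<le> (norm y)\<^sup>2" using that R by (intro power_mono) auto
    then show ?thesis using d R by (simp add: \<beta>_def mult_le_0_iff)
  qed
  show ?thesis
  proof
    have "\<not> R \<le> norm x" using neg[of x] big le[of x] by linarith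
    then show "x \<in> ball 0 R" by simp
    have "\<beta> x \<le> \<delta>" using d by (simp add: \<beta>_def mult_le_cancel_left1)
    then show "M - \<delta> < u x" using big by linarith
    fix y
    have "u y + \<beta> y \<le> u x + \<beta> x"
      using x(2)[of y] neg[of y] big le[of y] by (cases "norm y \<le> R") auto
    moreover have "\<beta> y - \<beta> x = \<delta> * ((norm x)\<^sup>2 - (norm y)\<^sup>2) / R\<^sup>2"
      by (simp add: \<beta>_def algebra_simps diff_divide_distrib)
    ultimately show "\<delta> * ((norm x)\<^sup>2 - (norm y)\<^sup>2) / R\<^sup>2 \<le> u x - u y" by linarith
  qed
qed

text \<open>Supplies two copies of \<open>(h / 4) powr (p - 1)\<close> from a gap
  \<open>h / 2\<close>: one absorbs the linear part of the paraboloid, the other remains as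
  gain.\<close>

lemma two_mult_powr_le:
  fixes t q :: real
  assumes "0 \<le> t" "1 \<le> q"
  shows "2 * t powr q \<le> (2 * t) powr q"
proof -
  have "2 powr 1 \<le> 2 powr q" using assms by (intro powr_mono) auto
  then show ?thesis using assms by (simp add: powr_mult mult_right_mono)
qed

text \<open>Here \<open>t\<close> stands for \<open>u x - u y\<close>. The four terms are the linear
  part of the paraboloid, odd about \<open>x\<close>; the error caused by its quadratic part; the
  worst case \<open>- \<delta>\<close> far from \<open>x\<close>; and the gain on
  \<open>D\<close>.\<close>

lemma signed_powr_touching_ge:
  fixes x y :: "'a::euclidean_space"
  assumes p: "2 \<le> p" and R: "0 < R" and d: "0 < \<delta>" "\<delta> \<le> h / 8"
    and x: "norm x < R"
    and touch: "\<delta> * ((norm x)\<^sup>2 - (norm y)\<^sup>2) / R\<^sup>2 \<le> t"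
    and low: "- \<delta> \<le> t" and D: "y \<in> D \<Longrightarrow> h / 2 \<le> t"
  shows "signed_powr p (- 2 * \<delta> * (x \<bullet> (y - x)) / R\<^sup>2) * indicator (ball x R) y
     - (p - 1) * 3 powr (p - 2) * \<delta> powr (p - 1) * R powr (- p) * norm (x - y) powr p * indicator (ball x R - {x}) y
     - \<delta> powr (p - 1) * indicator (- ball x R) y
     + (h / 4) powr (p - 1) * indicator D y \<le> signed_powr p t"
proof -
  define \<rho> where "\<rho> = norm (x - y)"
  define l where "l = - 2 * \<delta> * (x \<bullet> (y - x)) / R\<^sup>2"
  define K where "K = (p - 1) * 3 powr (p - 2) * \<delta> powr (p - 1) * R powr (- p)"
  have \<rho>0: "0 \<le> \<rho>" by (simp add: \<rho>_def)
  have K0: "0 \<le> K" using p by (simp add: K_def)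
  have hd: "0 < h" using d by linarith
  have in_ball: "y \<in> ball x R \<longleftrightarrow> \<rho> < R" by (simp add: \<rho>_def dist_norm)
  have labs: "\<bar>l\<bar> \<le> 2 * \<delta> * \<rho> / R"
  proof -
    have "\<bar>x \<bullet> (y - x)\<bar> \<le> norm x * \<rho>"
      using Cauchy_Schwarz_ineq2[of x "y - x"] by (simp add: \<rho>_def norm_minus_commute)
    also have "\<dots> \<le> R * \<rho>" using x \<rho>0 by (intro mult_right_mono) auto
    finally have "2 * \<delta> * \<bar>x \<bullet> (y - x)\<bar> / R\<^sup>2 \<le> 2 * \<delta> * (R * \<rho>) / R\<^sup>2"
      using d by (intro divide_right_mono mult_left_mono) auto
    then show ?thesis using R d by (simp add: l_def abs_mult power2_eq_square)
  qed
  have G: "signed_powr p l \<le> signed_powr p (2 * \<delta>)" if "\<rho> < R"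
  proof -
    have "\<rho> / R \<le> 1" using that R by simp
    then have "2 * \<delta> * (\<rho> / R) \<le> 2 * \<delta> * 1" using d by (intro mult_left_mono) auto
    with labs have "l \<le> 2 * \<delta>" by simp
    then show ?thesis by (rule signed_powr_mono[OF p])
  qed
  have near: "signed_powr p l - K * \<rho> powr p \<le> signed_powr p t" if "\<rho> < R"
  proof (cases "\<rho> = 0")
    case True
    then have "l = 0" "0 \<le> t" using touch by (auto simp: \<rho>_def l_def)
    then show ?thesis using True p signed_powr_mono[OF p, of 0 t] by simp
  next
    case False
    then have \<rho>: "0 < \<rho>" using \<rho>0 by simp
    define b where "b = \<delta> * \<rho>\<^sup>2 / R\<^sup>2"
    have b0: "0 \<le> b" using d by (simp add: b_def)
    \<comment> \<open>Expansion of \<open>(norm y)\<^sup>2\<close> about \<open>x\<close>: it splits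
      the touching bound into the linear part \<open>l\<close> and the quadratic part
      \<open>b\<close>.\<close>
    have sq: "(norm x)\<^sup>2 - (norm y)\<^sup>2 = - 2 * (x \<bullet> (y - x)) - \<rho>\<^sup>2"
      by (simp add: \<rho>_def power2_norm_eq_inner algebra_simps inner_commute)
    have "\<delta> * ((norm x)\<^sup>2 - (norm y)\<^sup>2) / R\<^sup>2 = l - b"
      unfolding sq l_def b_def by (simp add: right_diff_distrib diff_divide_distrib mult_ac)
    then have "l - b \<le> t" using touch by simp
    then have "signed_powr p (l - b) \<le> signed_powr p t" by (rule signed_powr_mono[OF p])
    moreover have "signed_powr p l - signed_powr p (l - b) \<le> (p - 1) * (\<bar>l\<bar> + b) powr (p - 2) * b"
      by (rule signed_powr_diff_le[OF p b0])
    \<comment> \<open>For \<open>\<rho> < R\<close> both \<open>\<bar>l\<bar>\<close> and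
      \<open>b\<close> are of order \<open>\<delta> * \<rho> / R\<close>. The error is then of order
      \<open>\<rho> powr p\<close>, which is integrable against the kernel near \<open>x\<close>
      because \<open>s < 1\<close>.\<close>
    moreover have "(p - 1) * (\<bar>l\<bar> + b) powr (p - 2) * b \<le> (p - 1) * (3 * \<delta> * \<rho> / R) powr (p - 2) * b"
    proof -
      have "\<delta> * \<rho> / R * (\<rho> / R) \<le> \<delta> * \<rho> / R * 1" using d \<rho> R that by (intro mult_left_mono) auto
      then have "b \<le> \<delta> * \<rho> / R" by (simp add: b_def power2_eq_square)
      then have "\<bar>l\<bar> + b \<le> 3 * \<delta> * \<rho> / R" using labs by simp
      then show ?thesis using p b0 by (intro mult_right_mono mult_left_mono powr_mono2) auto
    qed
    moreover have "(p - 1) * (3 * \<delta> * \<rho> / R) powr (p - 2) * b = K * \<rho> powr p"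
    proof -
      have split: "\<rho> powr p = \<rho> powr (p - 2) * \<rho>\<^sup>2" "R powr p = R powr (p - 2) * R\<^sup>2"
        "\<delta> powr (p - 1) = \<delta> powr (p - 2) * \<delta>"
        using d R \<rho> powr_add[of \<rho> "p - 2" 2] powr_add[of R "p - 2" 2] powr_add[of \<delta> "p - 2" 1]
        by simp_all
      have "(3 * \<delta> * \<rho> / R) powr (p - 2) = 3 powr (p - 2) * \<delta> powr (p - 2) * \<rho> powr (p - 2) / R powr (p - 2)"
        using d R \<rho> by (simp add: powr_mult powr_divide)
      moreover have "R powr (- p) = 1 / (R powr (p - 2) * R\<^sup>2)"
        using split(2) by (simp add: powr_minus_divide)
      ultimately show ?thesis
        unfolding K_def b_def split(1,3) by (simp add: mult_ac)
    qed
    ultimately show ?thesis by linarith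
  qed
  have far: "- (\<delta> powr (p - 1)) \<le> signed_powr p t"
  proof -
    have "- (\<delta> powr (p - 1)) = signed_powr p (- \<delta>)" using p d by (simp add: signed_powr_nonneg_eq)
    also have "\<dots> \<le> signed_powr p t" by (rule signed_powr_mono[OF p low])
    finally show ?thesis .
  qed
  have onD: "2 * (h / 4) powr (p - 1) \<le> signed_powr p t" if "y \<in> D"
  proof -
    have "2 * (h / 4) powr (p - 1) \<le> (2 * (h / 4)) powr (p - 1)" using p hd by (intro two_mult_powr_le) auto
    also have "\<dots> = signed_powr p (h / 2)" using p hd by (simp add: signed_powr_nonneg_eq)
    also have "\<dots> \<le> signed_powr p t" by (rule signed_powr_mono[OF p D[OF that]])
    finally show ?thesis .
  qed
  \<comment> \<open>This is the purpose of \<open>\<delta> \<le> h / 8\<close>: the linear part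
    costs at most one of the two copies of \<open>(h / 4) powr (p - 1)\<close>.\<close>
  have "signed_powr p (2 * \<delta>) \<le> (h / 4) powr (p - 1)"
    using p d by (simp add: signed_powr_nonneg_eq powr_mono2)
  then have nearD: "signed_powr p l + (h / 4) powr (p - 1) \<le> signed_powr p t" if "y \<in> D" "\<rho> < R"
    using G onD that by linarith
  have Kr: "0 \<le> K * \<rho> powr p" using K0 by simp
  \<comment> \<open>Removing the centre changes nothing, since \<open>0 powr p = 0\<close>.\<close>
  have ind: "K * \<rho> powr p * indicator (ball x R - {x}) y = (if \<rho> < R then K * \<rho> powr p else 0)"
    by (cases "x = y") (auto simp: \<rho>_def dist_norm)
  have "signed_powr p l * indicator (ball x R) y - K * \<rho> powr p * indicator (ball x R - {x}) y
     - \<delta> powr (p - 1) * indicator (- ball x R) y + (h / 4) powr (p - 1) * indicator D y \<le> signed_powr p t"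
  proof (cases "\<rho> < R")
    case True
    then have "indicator (ball x R) y = (1::real)" "indicator (- ball x R) y = (0::real)"
      using in_ball by auto
    then show ?thesis unfolding ind using True near nearD Kr by (cases "y \<in> D") auto
  next
    case False
    then have "indicator (ball x R) y = (0::real)" "indicator (- ball x R) y = (1::real)"
      using in_ball by auto
    moreover have "(h / 4) powr (p - 1) - \<delta> powr (p - 1) \<le> signed_powr p t" if "y \<in> D"
      using onD[OF that] powr_ge_zero[of \<delta> "p - 1"] powr_ge_zero[of "h / 4" "p - 1"] by linarith
    ultimately show ?thesis unfolding ind using False far by (cases "y \<in> D") auto
  qed
  then show ?thesis unfolding K_def \<rho>_def l_def .
qed

section \<open>Integration of the pointwise lower bound\<close>

text \<open>The linear term integrates to 0 because the annulus between the balls of radii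
  \<open>\<epsilon>\<close> and \<open>R\<close> is symmetric about \<open>x\<close>. The resulting
  bound is free of \<open>\<epsilon>\<close>, so it survives the limit in the principal
  value.\<close>

lemma kernel_bound_integral_ge:
  fixes x :: "'a::euclidean_space"
  defines "n \<equiv> real DIM('a)"
  assumes p: "2 \<le> p" and s: "0 < s" "s < 1" and R: "0 < R" and \<epsilon>: "0 < \<epsilon>" "\<epsilon> \<le> R / 4"
    and D: "D \<in> lmeasurable" "unit_ball_vol n * R ^ DIM('a) / 2 \<le> measure lebesgue D"
    and nonneg: "0 \<le> A" "0 \<le> B" "0 \<le> C"
    and F: "set_integrable lebesgue (UNIV - ball x \<epsilon>) F"
    and le: "\<And>y. y \<noteq> x \<Longrightarrow>
      signed_powr p (a \<bullet> (y - x)) * norm (x - y) powr (- (n + s * p)) * indicator (ball x R) y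
      - A * (norm (x - y) powr (p - s * p - n) * indicator (ball x R - {x}) y)
      - B * (norm (x - y) powr (- (s * p) - n) * indicator (- ball x R) y)
      + C * indicator D y \<le> F y"
  shows "C * (unit_ball_vol n * R ^ DIM('a) / 4)
      - A * (2 powr \<bar>p - s * p - n\<bar> * unit_ball_vol n * (R powr (p - s * p) / (1 - 2 powr (- (p - s * p)))))
      - B * (2 powr \<bar>- (s * p) - n\<bar> * unit_ball_vol n * (R powr (- (s * p)) * 2 powr (- (s * p)) / (1 - 2 powr (- (s * p)))))
    \<le> (LINT y:UNIV - ball x \<epsilon>|lebesgue. F y)"
proof -
  \<comment> \<open>Only \<open>T1\<close> and \<open>T4\<close> are cut off near \<open>x\<close>.
    \<open>T2\<close> and \<open>T3\<close> are nonnegative and enter with a minus sign, so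
    integrating them over the whole space only lowers the bound.\<close>
  define T1 where "T1 y = indicator (UNIV - ball x \<epsilon>) y *
    (signed_powr p (a \<bullet> (y - x)) * norm (x - y) powr (- (n + s * p)) * indicator (ball x R) y)" for y
  define T2 where "T2 y = norm (x - y) powr (p - s * p - n) * indicator (ball x R - {x}) y" for y
  define T3 where "T3 y = norm (x - y) powr (- (s * p) - n) * indicator (- ball x R) y" for y
  define T4 where "T4 y = (indicator (D - ball x \<epsilon>) y :: real)" for y
  have sp: "0 < s * p" "0 < p - s * p" using p s by auto
  have T2: "integrable lebesgue T2" "integral\<^sup>L lebesgue T2 \<le>
      2 powr \<bar>p - s * p - n\<bar> * unit_ball_vol n * (R powr (p - s * p) / (1 - 2 powr (- (p - s * p))))"
    using integrable_norm_powr_ball[OF sp(2) R, of x] integral_norm_powr_ball_le[OF sp(2) R, of x]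
    by (simp_all add: T2_def[abs_def] n_def)
  have T3: "integrable lebesgue T3" "integral\<^sup>L lebesgue T3 \<le>
      2 powr \<bar>- (s * p) - n\<bar> * unit_ball_vol n * (R powr (- (s * p)) * 2 powr (- (s * p)) / (1 - 2 powr (- (s * p))))"
    using integrable_norm_powr_outside[OF sp(1) R, of x] integral_norm_powr_outside_le[OF sp(1) R, of x]
    by (simp_all add: T3_def[abs_def] n_def)
  have [measurable]: "ball x \<epsilon> \<in> sets borel" "ball x R \<in> sets borel" by auto
  have T1_meas: "T1 \<in> borel_measurable lebesgue"
    unfolding T1_def by (intro measurable_completion) measurable
  have T1_int: "integrable lebesgue T1"
  proof (rule Bochner_Integration.integrable_bound[OF _ T1_meas])
    \<comment> \<open>Away from the \<open>\<epsilon>\<close>-ball the kernel is bounded, so a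
      constant on the ball of radius \<open>R\<close> dominates \<open>T1\<close>.\<close>
    let ?b = "\<lambda>y. (signed_powr p (norm a * R) * \<epsilon> powr (- (n + s * p))) * indicator (ball x R) y"
    show "integrable lebesgue ?b"
      using emeasure_lborel_ball_finite[of x R]
      by (intro integrable_mult_right integrable_real_indicator) auto
    have "norm (T1 y) \<le> norm (?b y)" for y
    proof (cases "y \<in> ball x R - ball x \<epsilon>")
      case True
      then have y: "\<epsilon> \<le> norm (x - y)" "norm (x - y) < R" by (auto simp: dist_norm)
      have "\<bar>a \<bullet> (y - x)\<bar> \<le> norm a * norm (y - x)" by (rule Cauchy_Schwarz_ineq2)
      also have "\<dots> \<le> norm a * R" using y by (intro mult_left_mono) (auto simp: norm_minus_commute)
      finally have a: "\<bar>a \<bullet> (y - x)\<bar> \<le> norm a * R" .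
      have "\<bar>signed_powr p (a \<bullet> (y - x))\<bar> = signed_powr p \<bar>a \<bullet> (y - x)\<bar>"
        by (simp add: signed_powr_def abs_mult)
      also have "\<dots> \<le> signed_powr p (norm a * R)" by (rule signed_powr_mono[OF p a])
      finally have 1: "\<bar>signed_powr p (a \<bullet> (y - x))\<bar> \<le> signed_powr p (norm a * R)" .
      have 2: "norm (x - y) powr (- (n + s * p)) \<le> \<epsilon> powr (- (n + s * p))"
        using y \<epsilon> sp by (intro powr_mono2') (auto simp: n_def)
      have "\<bar>signed_powr p (a \<bullet> (y - x))\<bar> * norm (x - y) powr (- (n + s * p))
          \<le> signed_powr p (norm a * R) * \<epsilon> powr (- (n + s * p))"
        using 1 2 by (intro mult_mono) (auto intro: order_trans[OF abs_ge_zero])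
      then show ?thesis using True 1 by (simp add: T1_def abs_mult)
    qed (auto simp: T1_def indicator_def)
    then show "AE y in lebesgue. norm (T1 y) \<le> norm (?b y)" by simp
  qed
  have T1_0: "integral\<^sup>L lebesgue T1 = 0"
  proof (rule lebesgue_integral_odd_about[where x = x])
    show "T1 (x - z) = - T1 (x + z)" for z
      by (simp add: T1_def indicator_def dist_norm)
  qed (rule T1_meas)
  have Dm: "D - ball x \<epsilon> \<in> lmeasurable"
    using D by (intro fmeasurable_Diff) auto
  have T4: "integrable lebesgue T4" "integral\<^sup>L lebesgue T4 = measure lebesgue (D - ball x \<epsilon>)"
    unfolding T4_def using Dm by (auto simp: fmeasurable_def)
  \<comment> \<open>The excised ball has at most a quarter of the volume of a ball of radius
    \<open>R\<close>, while \<open>D\<close> has at least half of it; a quarter remains.\<close>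
  have "\<epsilon> ^ DIM('a) \<le> (R / 4) ^ DIM('a)" using \<epsilon> by (intro power_mono) auto
  also have "\<dots> \<le> R ^ DIM('a) / 4"
  proof -
    have "(4::real) ^ 1 \<le> 4 ^ DIM('a)" by (intro power_increasing) (auto simp: Suc_le_eq)
    then have "R ^ DIM('a) / 4 ^ DIM('a) \<le> R ^ DIM('a) / 4"
      using R by (intro divide_left_mono) auto
    then show ?thesis by (simp add: power_divide)
  qed
  finally have "unit_ball_vol n * \<epsilon> ^ DIM('a) \<le> unit_ball_vol n * (R ^ DIM('a) / 4)"
    by (intro mult_left_mono) (auto simp: n_def)
  then have "measure lebesgue (ball x \<epsilon>) \<le> unit_ball_vol n * R ^ DIM('a) / 4"
    using \<epsilon> by (simp add: content_ball n_def)
  moreover have "measure lebesgue D \<le> measure lebesgue (D - ball x \<epsilon>) + measure lebesgue (ball x \<epsilon>)"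
  proof -
    have "measure lebesgue D \<le> measure lebesgue ((D - ball x \<epsilon>) \<union> ball x \<epsilon>)"
      using D Dm by (intro measure_mono_fmeasurable fmeasurable.Un) (auto simp: fmeasurableD)
    also have "\<dots> \<le> measure lebesgue (D - ball x \<epsilon>) + measure lebesgue (ball x \<epsilon>)"
      using Dm by (intro measure_Un_le) (auto simp: fmeasurableD)
    finally show ?thesis .
  qed
  ultimately have mD: "unit_ball_vol n * R ^ DIM('a) / 4 \<le> integral\<^sup>L lebesgue T4"
    using D(2) T4 by linarith
  have "C * integral\<^sup>L lebesgue T4 - A * integral\<^sup>L lebesgue T2 - B * integral\<^sup>L lebesgue T3
      = (LINT y|lebesgue. T1 y - A * T2 y - B * T3 y + C * T4 y)"
    using T1_int T1_0 T2(1) T3(1) T4(1) by simp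
  also have "\<dots> \<le> (LINT y:UNIV - ball x \<epsilon>|lebesgue. F y)"
    unfolding set_lebesgue_integral_def
  proof (rule integral_mono)
    show "integrable lebesgue (\<lambda>y. indicator (UNIV - ball x \<epsilon>) y *\<^sub>R F y)"
      using F by (simp add: set_integrable_def)
    fix y
    show "T1 y - A * T2 y - B * T3 y + C * T4 y \<le> indicator (UNIV - ball x \<epsilon>) y *\<^sub>R F y"
    proof (cases "y \<in> ball x \<epsilon>")
      case True
      moreover have "0 \<le> A * T2 y" "0 \<le> B * T3 y" using nonneg by (auto simp: T2_def T3_def)
      ultimately show ?thesis by (simp add: T1_def T4_def)
    next
      case False
      then have "y \<noteq> x" using \<epsilon> by auto
      from le[OF this] False show ?thesis by (simp add: T1_def T2_def T3_def T4_def indicator_def)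
    qed
  qed (use T1_int T2(1) T3(1) T4(1) in simp)
  finally have "C * integral\<^sup>L lebesgue T4 - A * integral\<^sup>L lebesgue T2 - B * integral\<^sup>L lebesgue T3
      \<le> (LINT y:UNIV - ball x \<epsilon>|lebesgue. F y)" .
  moreover have "C * (unit_ball_vol n * R ^ DIM('a) / 4) \<le> C * integral\<^sup>L lebesgue T4"
    using mD nonneg by (intro mult_left_mono)
  moreover note mult_left_mono[OF T2(2) nonneg(1)] mult_left_mono[OF T3(2) nonneg(2)]
  ultimately show ?thesis by linarith
qed

subsection \<open>Decay of the supremum\<close>

text \<open>With \<open>\<delta>\<close> proportional to \<open>h\<close>, gain and loss both scale
  as \<open>R powr (- (s * p)) * h powr (p - 1)\<close>. Only a comparison of constants in
  \<open>n\<close>, \<open>s\<close> and \<open>p\<close> remains, so \<open>\<theta>\<close> can be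
  chosen before \<open>u\<close>, \<open>R\<close>, \<open>M\<close> and \<open>h\<close>.\<close>

lemma sup_decay:
  assumes s: "0 < s" "s < 1" and p: "2 \<le> p" and c: "0 < c"
  obtains \<theta> where "0 < \<theta>"
    "\<And>(u :: 'a::euclidean_space \<Rightarrow> real) R M h x. continuous_on UNIV u \<Longrightarrow> (\<And>y. u y \<le> M) \<Longrightarrow>
      (\<And>x. has_frac_p_laplacian c s p u x 0) \<Longrightarrow> 0 < R \<Longrightarrow> 0 < h \<Longrightarrow>
      measure lebesgue (ball 0 R :: 'a set) / 2 \<le> measure lebesgue (ball 0 R \<inter> {y. u y \<le> M - h}) \<Longrightarrow>
      x \<in> ball 0 (R / 2) \<Longrightarrow> u x \<le> M - \<theta> * h"
proof -
  define n where "n = real DIM('a)"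
  define \<omega> where "\<omega> = unit_ball_vol n"
  \<comment> \<open>In units of \<open>R powr (- (s * p)) * h powr (p - 1)\<close>, the gain on
    \<open>D\<close> will be \<open>c0\<close> and the total loss
    \<open>\<theta> powr (p - 1) * c1\<close>; \<open>C2\<close> and \<open>C3\<close> come from the
    integrals inside and outside the ball.\<close>
  define C2 where "C2 = 2 powr \<bar>p - s * p - n\<bar> * \<omega> / (1 - 2 powr (- (p - s * p)))"
  define C3 where "C3 = 2 powr \<bar>- (s * p) - n\<bar> * \<omega> * 2 powr (- (s * p)) / (1 - 2 powr (- (s * p)))"
  define c1 where "c1 = (p - 1) * 3 powr (p - 2) * C2 + C3"
  define c0 where "c0 = (1 / 4) powr (p - 1) * 2 powr (- (n + s * p)) * \<omega> / 4"
  \<comment> \<open>The bound \<open>1 / 8\<close> yields \<open>\<delta> \<le> h / 8\<close>. The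
    other makes the loss smaller than \<open>c0\<close>, using
    \<open>\<theta> powr (p - 1) \<le> \<theta>\<close>; the added 1 keeps the denominator
    positive.\<close>
  define \<theta> where "\<theta> = min (1 / 8) (c0 / (2 * (c1 + 1)))"
  have sp: "0 < s * p" "0 < p - s * p" using p s by auto
  have \<omega>0: "0 < \<omega>" by (simp add: \<omega>_def n_def)
  have "2 powr (- (p - s * p)) < (1::real)" "2 powr (- (s * p)) < (1::real)"
    using sp by (auto intro!: powr_less_one)
  then have "0 \<le> C2" "0 \<le> C3" using \<omega>0 by (auto simp: C2_def C3_def)
  then have c1: "0 \<le> c1" using p by (auto simp: c1_def)
  have c0: "0 < c0" using \<omega>0 by (simp add: c0_def)
  have \<theta>: "0 < \<theta>" "\<theta> \<le> 1 / 8"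
    using c0 c1 min.cobounded1[of "1 / 8" "c0 / (2 * (c1 + 1))"] by (simp_all only: \<theta>_def) simp
  have "\<theta> powr (p - 1) \<le> \<theta> powr 1" using \<theta> p by (intro powr_mono') auto
  then have "\<theta> powr (p - 1) * c1 \<le> \<theta> * c1" using \<theta> c1 by (intro mult_right_mono) auto
  also have "\<dots> \<le> c0 / (2 * (c1 + 1)) * c1" using c1 by (intro mult_right_mono) (auto simp: \<theta>_def)
  also have "\<dots> < c0" using c0 c1 by (simp add: field_simps add_nonneg_pos)
  finally have small: "\<theta> powr (p - 1) * c1 < c0" .
  show ?thesis
  \<comment> \<open>The touching point requires a value above \<open>M - \<delta> / 2\<close> with
    \<open>\<delta> = \<theta> * h\<close>, hence the half.\<close>
  proof (rule that[of "\<theta> / 2"])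
    fix u :: "'a \<Rightarrow> real" and R M h :: real and x0 :: 'a
    assume cont: "continuous_on UNIV u" and le: "\<And>y. u y \<le> M"
      and lap: "\<And>x. has_frac_p_laplacian c s p u x 0" and R: "0 < R" and h: "0 < h"
      and half: "measure lebesgue (ball 0 R :: 'a set) / 2 \<le> measure lebesgue (ball 0 R \<inter> {y. u y \<le> M - h})"
      and x0: "x0 \<in> ball 0 (R / 2)"
    show "u x0 \<le> M - \<theta> / 2 * h"
    proof (rule ccontr)
      assume neg: "\<not> ?thesis"
      define \<delta> where "\<delta> = \<theta> * h"
      have d: "0 < \<delta>" "\<delta> \<le> h / 8" using \<theta> h by (auto simp: \<delta>_def)
      have "M - \<delta> / 2 < u x0" using neg by (simp add: \<delta>_def)
      from touching_point_exists[OF cont le R d(1) x0 this]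
      obtain x where x: "x \<in> ball 0 R" "M - \<delta> < u x"
        and touch: "\<And>y. \<delta> * ((norm x)\<^sup>2 - (norm y)\<^sup>2) / R\<^sup>2 \<le> u x - u y" by blast
      define D where "D = ball 0 R \<inter> {y. u y \<le> M - h}"
      have "closed {y. u y \<le> M - h}"
        using cont by (intro closed_Collect_le continuous_on_const)
      then have D: "D \<in> lmeasurable"
        unfolding D_def by (intro fmeasurable_Int_fmeasurable) (auto intro: borel_closed)
      have Dhalf: "unit_ball_vol n * R ^ DIM('a) / 2 \<le> measure lebesgue D"
        using half R by (simp add: D_def n_def content_ball)
      define A where "A = (p - 1) * 3 powr (p - 2) * \<delta> powr (p - 1) * R powr (- p)"
      define C where "C = (h / 4) powr (p - 1) * (2 * R) powr (- (n + s * p))"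
      define a where "a = (- 2 * \<delta> / R\<^sup>2) *\<^sub>R x"
      have A0: "0 \<le> A" using p by (simp add: A_def)
      have B0: "0 \<le> \<delta> powr (p - 1)" and C0: "0 \<le> C" by (simp_all add: C_def)
      have pw: "signed_powr p (a \<bullet> (y - x)) * norm (x - y) powr (- (n + s * p)) * indicator (ball x R) y
          - A * (norm (x - y) powr (p - s * p - n) * indicator (ball x R - {x}) y)
          - \<delta> powr (p - 1) * (norm (x - y) powr (- (s * p) - n) * indicator (- ball x R) y)
          + C * indicator D y \<le> frac_p_integrand s p u x y" if "y \<noteq> x" for y
      proof -
        define \<rho> where "\<rho> = norm (x - y)"
        define P where "P = \<rho> powr (- (n + s * p))"
        have \<rho>: "0 < \<rho>" using that by (simp add: \<rho>_def)
        have t: "- \<delta> \<le> u x - u y" using x(2) le[of y] by linarith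
        have tD: "h / 2 \<le> u x - u y" if "y \<in> D" using that x(2) d(2) h by (auto simp: D_def)
        have nx: "norm x < R" using x by simp
        have al: "a \<bullet> (y - x) = - 2 * \<delta> * (x \<bullet> (y - x)) / R\<^sup>2" by (simp add: a_def)
        have "signed_powr p (a \<bullet> (y - x)) * indicator (ball x R) y
           - A * \<rho> powr p * indicator (ball x R - {x}) y
           - \<delta> powr (p - 1) * indicator (- ball x R) y
           + (h / 4) powr (p - 1) * indicator D y \<le> signed_powr p (u x - u y)"
          unfolding al A_def \<rho>_def by (rule signed_powr_touching_ge[OF p R d nx touch t tD])
        then have "P * (signed_powr p (a \<bullet> (y - x)) * indicator (ball x R) y
           - A * \<rho> powr p * indicator (ball x R - {x}) y
           - \<delta> powr (p - 1) * indicator (- ball x R) y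
           + (h / 4) powr (p - 1) * indicator D y) \<le> P * signed_powr p (u x - u y)"
          by (intro mult_left_mono) (auto simp: P_def)
        moreover have "P * signed_powr p (u x - u y) = frac_p_integrand s p u x y"
          unfolding P_def powr_minus_divide by (simp add: frac_p_integrand_def signed_powr_def \<rho>_def n_def)
        moreover have "\<rho> powr (p - s * p - n) = P * \<rho> powr p"
          by (simp add: P_def powr_add[symmetric] algebra_simps)
        \<comment> \<open>On \<open>D\<close> both \<open>x\<close> and \<open>y\<close> lie in the
          ball of radius \<open>R\<close> about 0, so their distance is at most \<open>2 * R\<close>
          and the decreasing kernel is at least its value there.\<close>
        moreover have "C * indicator D y \<le> P * ((h / 4) powr (p - 1) * indicator D y)"
        proof (cases "y \<in> D")
          case True
          then have "\<rho> \<le> 2 * R" using norm_triangle_ineq4[of x y] nx by (simp add: \<rho>_def D_def)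
          then have "(2 * R) powr (- (n + s * p)) \<le> P"
            unfolding P_def using \<rho> sp by (intro powr_mono2') (auto simp: n_def)
          then have "C \<le> (h / 4) powr (p - 1) * P"
            unfolding C_def by (intro mult_left_mono) auto
          then show ?thesis using True by (simp add: mult_ac)
        qed simp
        moreover have P': "\<rho> powr (- (s * p) - n) = P"
          unfolding P_def by (rule arg_cong[where f = "\<lambda>e. \<rho> powr e"]) simp
        ultimately show ?thesis
          unfolding \<rho>_def[symmetric] P_def[symmetric] P' by (simp add: algebra_simps)
      qed
      \<comment> \<open>Since \<open>c > 0\<close>, the equation \<open>0 = c * I\<close> forces the
        principal value \<open>I\<close> itself to be 0.\<close>
      have lim: "((\<lambda>\<epsilon>. LINT y:UNIV - ball x \<epsilon>|lebesgue. frac_p_integrand s p u x y) \<longlongrightarrow> 0) (at_right 0)"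
        and int: "\<And>\<epsilon>. 0 < \<epsilon> \<Longrightarrow> set_integrable lebesgue (UNIV - ball x \<epsilon>) (frac_p_integrand s p u x)"
        using lap[of x] c by (auto simp: has_frac_p_laplacian_def)
      \<comment> \<open>Gain minus loss: a positive lower bound for all truncated integrals with
        small \<open>\<epsilon>\<close>, contradicting their limit 0.\<close>
      define \<kappa> where "\<kappa> = R powr (- (s * p)) * h powr (p - 1) * (c0 - \<theta> powr (p - 1) * c1)"
      have pw_split: "R powr (- p) * R powr (p - s * p) = R powr (- (s * p))"
        "R powr (- (n + s * p)) * R ^ DIM('a) = R powr (- (s * p))"
        using R by (simp_all add: powr_add[symmetric] powr_realpow[symmetric] n_def)
      have d_split: "\<delta> powr (p - 1) = \<theta> powr (p - 1) * h powr (p - 1)"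
        "(h / 4) powr (p - 1) = (1 / 4) powr (p - 1) * h powr (p - 1)"
        using \<theta> h powr_mult[of "1/4" h "p - 1"] by (simp_all add: \<delta>_def powr_mult)
      have R_split: "(2 * R) powr (- (n + s * p)) = 2 powr (- (n + s * p)) * R powr (- (n + s * p))"
        using R by (simp add: powr_mult)
      have low: "\<kappa> \<le> (LINT y:UNIV - ball x \<epsilon>|lebesgue. frac_p_integrand s p u x y)"
        if "0 < \<epsilon>" "\<epsilon> \<le> R / 4" for \<epsilon>
      proof -
        have "C * (\<omega> * R ^ DIM('a) / 4)
            = (1 / 4) powr (p - 1) * h powr (p - 1) * 2 powr (- (n + s * p)) * \<omega> / 4
              * (R powr (- (n + s * p)) * R ^ DIM('a))"
          unfolding C_def d_split R_split by (simp add: mult_ac)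
        also have "\<dots> = R powr (- (s * p)) * h powr (p - 1) * c0"
          unfolding pw_split c0_def by (simp add: mult_ac)
        finally have 1: "C * (\<omega> * R ^ DIM('a) / 4) = R powr (- (s * p)) * h powr (p - 1) * c0" .
        have "A * (2 powr \<bar>p - s * p - n\<bar> * \<omega> * (R powr (p - s * p) / (1 - 2 powr (- (p - s * p)))))
            = (p - 1) * 3 powr (p - 2) * \<theta> powr (p - 1) * h powr (p - 1) * C2 * (R powr (- p) * R powr (p - s * p))"
          unfolding A_def C2_def d_split by (simp add: mult_ac)
        then have 2: "A * (2 powr \<bar>p - s * p - n\<bar> * \<omega> * (R powr (p - s * p) / (1 - 2 powr (- (p - s * p)))))
            = R powr (- (s * p)) * h powr (p - 1) * (\<theta> powr (p - 1) * ((p - 1) * 3 powr (p - 2) * C2))"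
          unfolding pw_split by (simp add: mult_ac)
        have 3: "\<delta> powr (p - 1) * (2 powr \<bar>- (s * p) - n\<bar> * \<omega> * (R powr (- (s * p)) * 2 powr (- (s * p)) / (1 - 2 powr (- (s * p)))))
            = R powr (- (s * p)) * h powr (p - 1) * (\<theta> powr (p - 1) * C3)"
          unfolding C3_def d_split by (simp add: mult_ac)
        note kernel_bound_integral_ge[OF p s R that D Dhalf[unfolded n_def] A0 B0 C0 int[OF that(1)] pw[unfolded n_def],
            folded n_def, folded \<omega>_def, unfolded 1 2 3]
        moreover have "\<kappa> = R powr (- (s * p)) * h powr (p - 1) * c0
            - R powr (- (s * p)) * h powr (p - 1) * (\<theta> powr (p - 1) * ((p - 1) * 3 powr (p - 2) * C2))
            - R powr (- (s * p)) * h powr (p - 1) * (\<theta> powr (p - 1) * C3)"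
          by (simp add: \<kappa>_def c1_def algebra_simps)
        ultimately show ?thesis by simp
      qed
      have "eventually (\<lambda>\<epsilon>. \<epsilon> \<in> {0<..<R / 4}) (at_right 0)"
        using R by (intro eventually_at_right_real) auto
      then have "eventually (\<lambda>\<epsilon>. \<kappa> \<le> (LINT y:UNIV - ball x \<epsilon>|lebesgue. frac_p_integrand s p u x y)) (at_right 0)"
        by (rule eventually_mono) (use low in auto)
      then have "\<kappa> \<le> 0" by (rule tendsto_lowerbound[OF lim]) simp
      moreover have "0 < \<kappa>" unfolding \<kappa>_def using R h small by (intro mult_pos_pos) auto
      ultimately show False by simp
    qed
  qed (use \<theta> in simp)
qed

section \<open>From decay to the Liouville theorem\<close>

lemma has_frac_p_laplacian_minus:
  assumes "has_frac_p_laplacian c s p u x l"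
  shows "has_frac_p_laplacian c s p (\<lambda>y. - u y) x (- l)"
proof -
  have eq: "frac_p_integrand s p (\<lambda>y. - u y) x = (\<lambda>y. - frac_p_integrand s p u x y)"
  proof
    fix y
    show "frac_p_integrand s p (\<lambda>y. - u y) x y = - frac_p_integrand s p u x y"
      using signed_powr_minus[of p "u x - u y"] by (simp add: frac_p_integrand_def signed_powr_def)
  qed
  show ?thesis
    using assms unfolding has_frac_p_laplacian_def eq set_integrable_def set_lebesgue_integral_def
    by (auto intro!: tendsto_minus)
qed

lemma C11_loc_imp_continuous_on: "C11_loc u \<Longrightarrow> continuous_on S u"
  unfolding C11_loc_def gderiv_def
  by (meson continuous_at_imp_continuous_on has_derivative_continuous)

theorem theorem1:
  fixes u :: "real ^ 'n \<Rightarrow> real" and s p c :: real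
  assumes "0 < s" and "s < 1" and "2 \<le> p" and "0 < c"
    and "C11_loc u" and "u \<in> L_sp s p"
    and "bounded (range u)"
    and "\<And>x. has_frac_p_laplacian c s p u x 0"
  shows "\<exists>C. \<forall>x. u x = C"
proof -
  have cont: "continuous_on UNIV u" using assms(5) by (rule C11_loc_imp_continuous_on)
  have bdd: "bdd_above (range u)" "bdd_below (range u)"
    using assms(7) by (auto intro: bounded_imp_bdd_above bounded_imp_bdd_below)
  define M where "M = (SUP x. u x)"
  define m where "m = (INF x. u x)"
  define h where "h = (M - m) / 2"
  have le: "u y \<le> M" and ge: "- u y \<le> - m" for y
    using bdd by (auto simp: M_def m_def intro: cSUP_upper cINF_lower)
  \<comment> \<open>It matters that \<open>\<theta>\<close> is fixed before the radius:
    \<open>R\<close> below depends on points chosen in terms of \<open>\<theta>\<close>.\<close>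
  obtain \<theta> where "0 < \<theta>" and decay: "\<And>(v :: real ^ 'n \<Rightarrow> real) R M h x. continuous_on UNIV v \<Longrightarrow> (\<And>y. v y \<le> M) \<Longrightarrow>
      (\<And>x. has_frac_p_laplacian c s p v x 0) \<Longrightarrow> 0 < R \<Longrightarrow> 0 < h \<Longrightarrow>
      measure lebesgue (ball 0 R :: (real ^ 'n) set) / 2 \<le> measure lebesgue (ball 0 R \<inter> {y. v y \<le> M - h}) \<Longrightarrow>
      x \<in> ball 0 (R / 2) \<Longrightarrow> v x \<le> M - \<theta> * h"
    using sup_decay[OF assms(1-4)] by metis
  have "\<not> 0 < h"
  proof
    assume h: "0 < h"
    then have th: "0 < \<theta> * h" using \<open>0 < \<theta>\<close> by simp
    then obtain x0 where x0: "M - \<theta> * h < u x0"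
      using less_cSUP_iff[of UNIV u "M - \<theta> * h"] bdd by (auto simp: M_def)
    obtain y0 where y0: "u y0 < m + \<theta> * h"
      using cINF_less_iff[of UNIV u "m + \<theta> * h"] bdd th by (auto simp: m_def)
    \<comment> \<open>Large enough for both nearly extremal points to lie in the ball of radius
      \<open>R / 2\<close>, where the decay applies.\<close>
    define R where "R = 2 * (norm x0 + norm y0 + 1)"
    have R: "0 < R" by (simp add: R_def add_nonneg_pos)
    have in_ball: "x0 \<in> ball 0 (R / 2)" "y0 \<in> ball 0 (R / 2)"
      by (auto simp: R_def intro: add_nonneg_pos add_pos_nonneg)
    let ?low = "ball 0 R \<inter> {y. u y \<le> M - h}" and ?high = "ball 0 R \<inter> {y. - u y \<le> - m - h}"
    have "closed {y. u y \<le> M - h}" "closed {y. - u y \<le> - m - h}"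
      by (auto intro!: closed_Collect_le continuous_intros cont)
    then have sets: "{y. u y \<le> M - h} \<in> sets lebesgue" "{y. - u y \<le> - m - h} \<in> sets lebesgue"
      by (auto intro: borel_closed)
    have meas: "?low \<in> lmeasurable" "?high \<in> lmeasurable"
      by (rule fmeasurable_Int_fmeasurable[OF lmeasurable_ball sets(1)])
        (rule fmeasurable_Int_fmeasurable[OF lmeasurable_ball sets(2)])
    \<comment> \<open>\<open>M - h\<close> and \<open>m + h\<close> are both the midpoint of
      \<open>m\<close> and \<open>M\<close>, so every value lies on one side of it, and one of the
      two sets fills at least half of the ball.\<close>
    have "ball 0 R \<subseteq> ?low \<union> ?high" by (auto simp: h_def field_simps)
    then have "measure lebesgue (ball (0 :: real ^ 'n) R) \<le> measure lebesgue (?low \<union> ?high)"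
      using meas by (intro measure_mono_fmeasurable fmeasurable.Un) auto
    also have "\<dots> \<le> measure lebesgue ?low + measure lebesgue ?high"
      using meas by (intro measure_Un_le) (auto simp: fmeasurableD)
    finally consider "measure lebesgue (ball (0 :: real ^ 'n) R) / 2 \<le> measure lebesgue ?low"
      | "measure lebesgue (ball (0 :: real ^ 'n) R) / 2 \<le> measure lebesgue ?high" by linarith
    then show False
    proof cases
      case 1
      from decay[OF cont le assms(8) R h 1 in_ball(1)] x0 show False by linarith
    next
      case 2
      \<comment> \<open>For \<open>- u\<close>, bounded above by \<open>- m\<close>, the decay gives
        \<open>u y0 \<ge> m + \<theta> * h\<close>, against the choice of \<open>y0\<close>.\<close>
      have "has_frac_p_laplacian c s p (\<lambda>y. - u y) x 0" for x
        using has_frac_p_laplacian_minus[OF assms(8)[of x]] by simp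
      from decay[OF continuous_on_minus[OF cont] ge this R h 2 in_ball(2)] y0 show False by linarith
    qed
  qed
  \<comment> \<open>From \<open>h \<le> 0\<close> follows \<open>M \<le> m\<close>, so the bounds
    \<open>m \<le> u x \<le> M\<close> collapse.\<close>
  then have "u x = m" for x using le[of x] ge[of x] by (simp add: h_def)
  then show ?thesis by blast
qed

end
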